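(* Let $I\subset\mathbb{R}$ be an interval, let $p\in\mathbb{R}\setminus\{0\}$, let $\alpha\in(0,1)$, let $u:I\to\mathbb{R}$ be hyperbolic $p$-convex on $I$, and let $a,b\in I$ with $a<b$. Let $v:I\to\mathbb{R}$ be a function which on $[a,b]$ is positive, integrable and symmetric (that is, $v(a+b-x)=v(x)$ for $x\in[a,b]$). Then $$\mathcal{I}^\alpha_{a+}[uv](b)+\mathcal{I}^\alpha_{b-}[uv](a)\;\leq\;\frac{u(a)+u(b)}{2}\cdot\frac{1}{\cosh\left(\frac{p(b-a)}{2}\right)}\,\mathcal{C}^2_\alpha(v)+\frac{u(a)-u(b)}{2}\cdot\frac{1}{\sinh\left(\frac{p(b-a)}{2}\right)}\,\mathcal{S}^2_\alpha(v),$$ where $$\mathcal{C}^2_{\alpha}(v):=\int_a^b\cosh\left[p\left(x-\frac{a+b}{2}\right)\right]\frac{\exp\left(-\frac{1-\alpha}{\alpha}(b-x)\right)+\exp\left(-\frac{1-\alpha}{\alpha}(x-a)\right)}{\alpha}\,v(x)\,dx,$$ $$\mathcal{S}^2_\alpha(v):=\int_a^b\sinh\left[p\left(x-\frac{a+b}{2}\right)\right]\frac{\exp\left(-\frac{1-\alpha}{\alpha}(b-x)\right)+\exp\left(-\frac{1-\alpha}{\alpha}(x-a)\right)}{\alpha}\,v(x)\,dx.$$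
   Context: A function $f:I\to\mathbb{R}$ is hyperbolic $p$-convex on $I$ if for every closed subinterval $[a,b]\subset I$ (with $a<b$) and all $x\in[a,b]$, $$f(x)\leq \frac{\sinh[p(b-x)]}{\sinh[p(b-a)]}f(a)+\frac{\sinh[p(x-a)]}{\sinh[p(b-a)]}f(b).$$ For $\alpha\in(0,1)$ and $f\in L_1(a,b)$, the fractional integrals with exponential kernel are $\mathcal{I}^\alpha_{a+}[f](x)=\frac1\alpha\int_a^x\exp\left(-\frac{1-\alpha}{\alpha}(x-s)\right)f(s)\,ds$ for $x>a$ and $\mathcal{I}^\alpha_{b-}[f](x)=\frac1\alpha\int_x^b\exp\left(-\frac{1-\alpha}{\alpha}(s-x)\right)f(s)\,ds$ for $x<b$; $uv$ denotes the pointwise product. *)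

theory Defs
  imports "HOL-Analysis.Analysis"
begin

definition hyperbolic_p_convex_on :: "real \<Rightarrow> real set \<Rightarrow> (real \<Rightarrow> real) \<Rightarrow> bool" where
  "hyperbolic_p_convex_on p I f \<longleftrightarrow>
     (\<forall>a b. a < b \<longrightarrow> {a..b} \<subseteq> I \<longrightarrow>
       (\<forall>x\<in>{a..b}.
          f x \<le> sinh (p * (b - x)) / sinh (p * (b - a)) * f a
               + sinh (p * (x - a)) / sinh (p * (b - a)) * f b))"

text \<open>All integrals are Lebesgue integrals over the Lebesgue sigma-algebra. As for any Bochner
  integral, the two operators below are meaningful only for integrable arguments, with
  \<open>a < x\<close> (left-sided) and \<open>x < b\<close> (right-sided).\<close>

definition frac_int_left :: "real \<Rightarrow> real \<Rightarrow> (real \<Rightarrow> real) \<Rightarrow> real \<Rightarrow> real" where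
  "frac_int_left \<alpha> a f x =
     1 / \<alpha> * (LINT s:{a..x}|lebesgue. exp (- ((1 - \<alpha>) / \<alpha>) * (x - s)) * f s)"

definition frac_int_right :: "real \<Rightarrow> real \<Rightarrow> (real \<Rightarrow> real) \<Rightarrow> real \<Rightarrow> real" where
  "frac_int_right \<alpha> b f x =
     1 / \<alpha> * (LINT s:{x..b}|lebesgue. exp (- ((1 - \<alpha>) / \<alpha>) * (s - x)) * f s)"

definition C2 :: "real \<Rightarrow> real \<Rightarrow> real \<Rightarrow> real \<Rightarrow> (real \<Rightarrow> real) \<Rightarrow> real" where
  "C2 p a b \<alpha> v =
     (LINT x:{a..b}|lebesgue.
        cosh (p * (x - (a + b) / 2))
        * ((exp (- ((1 - \<alpha>) / \<alpha>) * (b - x)) + exp (- ((1 - \<alpha>) / \<alpha>) * (x - a))) / \<alpha>)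
        * v x)"

definition S2 :: "real \<Rightarrow> real \<Rightarrow> real \<Rightarrow> real \<Rightarrow> (real \<Rightarrow> real) \<Rightarrow> real" where
  "S2 p a b \<alpha> v =
     (LINT x:{a..b}|lebesgue.
        sinh (p * (x - (a + b) / 2))
        * ((exp (- ((1 - \<alpha>) / \<alpha>) * (b - x)) + exp (- ((1 - \<alpha>) / \<alpha>) * (x - a))) / \<alpha>)
        * v x)"

end

theory Submission imports Defs begin

text \<open>
  Let \<open>m = (a + b) / 2\<close>. By the addition theorems, the hyperbolic chord of \<open>u\<close> over \<open>[a, b]\<close> is
  \<open>(u a + u b) / (2 cosh (p (b - a) / 2)) cosh (p (x - m))
    + (u b - u a) / (2 sinh (p (b - a) / 2)) sinh (p (x - m))\<close>,
  and \<open>u\<close> lies below it (\<open>hyperbolic_p_convex_on_le_centred_chord\<close>). The two fractional integrals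
  of \<open>u v\<close> add up to the integral of \<open>u v\<close> against the positive weight
  \<open>(exp (- ((1 - \<alpha>) / \<alpha>) (b - x)) + exp (- ((1 - \<alpha>) / \<alpha>) (x - a))) / \<alpha>\<close>, so multiplying the
  pointwise bound by this weight and by \<open>v\<close> and integrating bounds them by the corresponding
  combination of \<open>C2\<close> and \<open>S2\<close>. Weight and \<open>v\<close> are symmetric about \<open>m\<close> while
  \<open>sinh (p (x - m))\<close> is antisymmetric, so \<open>S2\<close> vanishes (\<open>set_integral_eq_0_if_antisymmetric\<close>);
  the sign of its coefficient is therefore immaterial.

  Integrating the inequality is legitimate only once \<open>u v\<close> is known to be integrable, because the
  integral of a non-integrable function is \<open>0\<close> by convention. For this it suffices that \<open>u\<close> is
  bounded and measurable on \<open>[a, b]\<close>. Boundedness from above is the chord bound; from below it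
  follows by comparing \<open>u x\<close> with \<open>u m\<close> and the mirror value \<open>u (2 m - x)\<close>. Measurability holds
  because \<open>u\<close> is continuous on \<open>(a, b)\<close>: the map \<open>exp (2 p x) \<mapsto> exp (p x) u x\<close> is convex in the
  usual sense, and convex functions on open intervals are continuous.
\<close>

section \<open>Bounds for hyperbolic convex functions\<close>

text \<open>With \<open>h = p (b - a) / 2\<close> and \<open>t = p (x - (a + b) / 2)\<close>, the coefficients of the chord are
  \<open>sinh (h \<mp> t) / sinh (2 h) = cosh t / (2 cosh h) \<mp> sinh t / (2 sinh h)\<close>, which separates
  the part of the chord that is even about the midpoint from the odd part.\<close>

lemma hyperbolic_p_convex_on_le_centred_chord:
  fixes p a b x :: real and u :: "real \<Rightarrow> real"
  assumes u: "hyperbolic_p_convex_on p I u" and I: "{a..b} \<subseteq> I"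
    and p: "p \<noteq> 0" and ab: "a < b" and x: "x \<in> {a..b}"
  shows "u x \<le> (u a + u b) / 2 / cosh (p * (b - a) / 2) * cosh (p * (x - (a + b) / 2))
             + (u b - u a) / 2 / sinh (p * (b - a) / 2) * sinh (p * (x - (a + b) / 2))"
proof -
  define h where "h = p * (b - a) / 2"
  define t where "t = p * (x - (a + b) / 2)"
  have h0: "sinh h \<noteq> 0" "cosh h \<noteq> 0"
    using p ab by (auto simp: h_def)
  have e: "p * (b - x) = h - t" "p * (x - a) = h + t" "p * (b - a) = 2 * h"
    by (auto simp: h_def t_def field_simps)
  have "u x \<le> sinh (p * (b - x)) / sinh (p * (b - a)) * u a
            + sinh (p * (x - a)) / sinh (p * (b - a)) * u b"
    using u I ab x unfolding hyperbolic_p_convex_on_def by blast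
  also have "\<dots> = (u a + u b) / 2 / cosh h * cosh t + (u b - u a) / 2 / sinh h * sinh t"
    unfolding e sinh_diff sinh_add sinh_double using h0 by (simp add: field_simps)
  finally show ?thesis by (simp add: h_def t_def)
qed

text \<open>The chord over \<open>[x, a + b - x]\<close>, evaluated at the midpoint, turns the upper bound for the
  mirror value into a lower bound for \<open>u x\<close>.\<close>

lemma hyperbolic_p_convex_on_bounded:
  fixes p a b :: real and u :: "real \<Rightarrow> real"
  assumes u: "hyperbolic_p_convex_on p {a..b} u" and p: "p \<noteq> 0" and ab: "a < b"
  shows "bounded (u ` {a..b})"
proof -
  define m where "m = (a + b) / 2"
  have m2: "2 * m = a + b" by (simp add: m_def)
  define F where "F x = (u a + u b) / 2 / cosh (p * (b - a) / 2) * cosh (p * (x - m))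
             + (u b - u a) / 2 / sinh (p * (b - a) / 2) * sinh (p * (x - m))" for x
  define G where "G x = 2 * cosh (p * (m - x)) * u m" for x
  have "continuous_on {a..b} F" "continuous_on {a..b} G"
    unfolding F_def G_def by (intro continuous_intros)+
  then have "bounded (F ` {a..b})" "bounded (G ` {a..b})"
    by (auto intro!: compact_imp_bounded compact_continuous_image)
  then obtain M N where M: "\<And>x. x \<in> {a..b} \<Longrightarrow> \<bar>F x\<bar> \<le> M" and N: "\<And>x. x \<in> {a..b} \<Longrightarrow> \<bar>G x\<bar> \<le> N"
    unfolding bounded_iff ball_simps(9) real_norm_def by meson
  have upper: "u x \<le> F x" if "x \<in> {a..b}" for x
    unfolding F_def m_def
    using hyperbolic_p_convex_on_le_centred_chord[OF u order.refl p ab that] .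
  have mid: "G x \<le> u x + u (2 * m - x)" if "a \<le> x" "x < m" for x
  proof -
    have sub: "{x..2 * m - x} \<subseteq> {a..b}" and lt: "x < 2 * m - x" and mem: "m \<in> {x..2 * m - x}"
      using that m2 by auto
    have e: "m - (x + (2 * m - x)) / 2 = 0" "p * (2 * m - x - x) / 2 = p * (m - x)"
      by (simp_all add: field_simps)
    have "u m \<le> (u x + u (2 * m - x)) / 2 / cosh (p * (m - x))"
      using hyperbolic_p_convex_on_le_centred_chord[OF u sub p lt mem] unfolding e by simp
    then show ?thesis by (simp add: G_def field_simps)
  qed
  have lower: "G x \<le> u x + u (2 * m - x)" if "x \<in> {a..b}" for x
  proof -
    consider "x < m" | "x = m" | "m < x" by linarith
    then show ?thesis
    proof cases
      case 3
      have "p * (m - (2 * m - x)) = - (p * (m - x))" by (simp add: algebra_simps)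
      then have "G (2 * m - x) = G x" unfolding G_def by simp
      then show ?thesis using mid[of "2 * m - x"] 3 that m2 by auto
    qed (use mid that in \<open>auto simp: G_def\<close>)
  qed
  have "\<bar>u x\<bar> \<le> N + M" if x: "x \<in> {a..b}" for x
  proof -
    have x': "2 * m - x \<in> {a..b}" using x m2 by auto
    show ?thesis
      using upper[OF x] upper[OF x'] lower[OF x] M[OF x] M[OF x'] N[OF x] by linarith
  qed
  then show ?thesis unfolding bounded_iff by (intro exI[of _ "N + M"]) simp
qed

section \<open>Continuity of hyperbolic convex functions\<close>

lemma hyperbolic_p_convex_on_uminus:
  "hyperbolic_p_convex_on (- p) I u \<longleftrightarrow> hyperbolic_p_convex_on p I u"
  by (simp add: hyperbolic_p_convex_on_def)

lemma sinh_ratio_eq_exp_ratio: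
  fixes p x y z w :: real
  assumes "p \<noteq> 0" "x \<noteq> y"
  shows "sinh (p * (w - z)) / sinh (p * (y - x))
       = (exp (2 * p * w) - exp (2 * p * z)) / (exp (2 * p * y) - exp (2 * p * x))
         * exp (p * (x + y - z - w))"
proof -
  have factor: "exp (2 * p * s) - exp (2 * p * r) = 2 * exp (p * (r + s)) * sinh (p * (s - r))"
    for r s :: real
    by (simp add: sinh_field_def algebra_simps exp_add[symmetric])
  have "sinh (p * (y - x)) \<noteq> 0" using assms by simp
  moreover have "exp (p * (x + y - z - w)) * exp (p * (z + w)) = exp (p * (x + y))"
    by (simp add: exp_add[symmetric] algebra_simps)
  ultimately show ?thesis
    unfolding factor by (simp add: field_simps)
qed

text \<open>Substituting \<open>y = exp (2 p x)\<close> turns the coefficients of the hyperbolic chord into the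
  coefficients of an ordinary chord, up to the factor \<open>exp (p x)\<close>, which is \<open>sqrt y\<close>.\<close>

lemma hyperbolic_p_convex_on_imp_convex_on:
  fixes p a b :: real and u :: "real \<Rightarrow> real"
  assumes u: "hyperbolic_p_convex_on p {a..b} u" and p: "0 < p"
  shows "convex_on {exp (2 * p * a)<..<exp (2 * p * b)} (\<lambda>y. sqrt y * u (ln y / (2 * p)))"
    (is "convex_on ?S _")
proof (rule convex_on_linorderI)
  fix t y z :: real
  assume t: "0 < t" "t < 1" and y: "y \<in> ?S" and z: "z \<in> ?S" and yz: "y < z"
  define s where "s = (1 - t) * y + t * z"
  have pos: "0 < y" "0 < z" using y z by (auto intro: less_trans[OF exp_gt_zero])
  have d: "s - y = t * (z - y)" "z - s = (1 - t) * (z - y)"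
    by (auto simp: s_def algebra_simps)
  have ts: "(z - s) / (z - y) = 1 - t" "(s - y) / (z - y) = t"
    unfolding d using yz by simp_all
  have "0 < t * (z - y)" "0 < (1 - t) * (z - y)" using yz t by simp_all
  then have "y < s" "s < z"
    unfolding d[symmetric] by simp_all
  then have s0: "0 < s" using pos by simp
  define l where "l r = ln r / (2 * p)" for r :: real
  have exp_l: "exp (2 * p * l r) = r" and sqrt_l: "sqrt r = exp (p * l r)" if "0 < r" for r
  proof -
    show 1: "exp (2 * p * l r) = r" using that p by (simp add: l_def)
    have "exp (p * l r) ^ 2 = r"
      using 1 exp_double[of "p * l r"] by (simp add: mult.assoc)
    then show "sqrt r = exp (p * l r)" by (metis abs_of_pos exp_gt_zero real_sqrt_abs)
  qed
  have l_mono: "l r < l q" if "0 < r" "r < q" for r q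
    using that p by (simp add: l_def divide_strict_right_mono)
  have ys: "l y < l s" "l s < l z" "l y < l z"
    using l_mono \<open>y < s\<close> \<open>s < z\<close> yz pos s0 by auto
  have "a \<le> l y" "l z \<le> b"
  proof -
    have "2 * p * a < ln y" "ln z < 2 * p * b"
      using y z pos ln_less_cancel_iff[of "exp (2 * p * a)" y] ln_less_cancel_iff[of z "exp (2 * p * b)"]
      by simp_all
    then show "a \<le> l y" "l z \<le> b" using p by (auto simp: l_def field_simps)
  qed
  then have "u (l s) \<le> sinh (p * (l z - l s)) / sinh (p * (l z - l y)) * u (l y)
                    + sinh (p * (l s - l y)) / sinh (p * (l z - l y)) * u (l z)"
    using u ys unfolding hyperbolic_p_convex_on_def by auto
  also have "sinh (p * (l z - l s)) / sinh (p * (l z - l y)) = (1 - t) * exp (p * (l y - l s))"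
    using sinh_ratio_eq_exp_ratio[of p "l y" "l z" "l z" "l s"] p ys pos s0
    by (simp add: exp_l ts)
  also have "sinh (p * (l s - l y)) / sinh (p * (l z - l y)) = t * exp (p * (l z - l s))"
    using sinh_ratio_eq_exp_ratio[of p "l y" "l z" "l s" "l y"] p ys pos s0
    by (simp add: exp_l ts)
  finally have "exp (p * l s) * u (l s)
      \<le> exp (p * l s) * ((1 - t) * exp (p * (l y - l s)) * u (l y)
                        + t * exp (p * (l z - l s)) * u (l z))"
    by simp
  also have "\<dots> = (1 - t) * (exp (p * l y) * u (l y)) + t * (exp (p * l z) * u (l z))"
    by (simp add: right_diff_distrib exp_diff distrib_left)
  finally have "sqrt s * u (l s) \<le> (1 - t) * (sqrt y * u (l y)) + t * (sqrt z * u (l z))"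
    using pos s0 by (simp add: sqrt_l)
  then show "sqrt ((1 - t) *\<^sub>R y + t *\<^sub>R z) * u (ln ((1 - t) *\<^sub>R y + t *\<^sub>R z) / (2 * p))
    \<le> (1 - t) * (sqrt y * u (ln y / (2 * p))) + t * (sqrt z * u (ln z / (2 * p)))"
    by (simp add: s_def l_def)
qed simp

text \<open>The substitution is increasing only for \<open>p > 0\<close>; hyperbolic convexity does not depend on the
  sign of \<open>p\<close>, since the ratios of hyperbolic sines do not. As for ordinary convexity, \<open>u\<close> may
  jump at the endpoints.\<close>

lemma hyperbolic_p_convex_on_continuous:
  fixes p a b :: real and u :: "real \<Rightarrow> real"
  assumes u: "hyperbolic_p_convex_on p {a..b} u" and p: "p \<noteq> 0"
  shows "continuous_on {a<..<b} u"
proof -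
  have *: "continuous_on {a<..<b} u" if u: "hyperbolic_p_convex_on p {a..b} u" and p: "0 < p" for p
  proof -
    define g where "g y = sqrt y * u (ln y / (2 * p))" for y
    have "continuous_on {exp (2 * p * a)<..<exp (2 * p * b)} g"
      unfolding g_def
      by (intro convex_on_continuous hyperbolic_p_convex_on_imp_convex_on u p open_greaterThanLessThan)
    then have "continuous_on {a<..<b} (\<lambda>x. g (exp (2 * p * x)))"
      by (rule continuous_on_compose2) (use p in \<open>auto intro!: continuous_intros\<close>)
    then have "continuous_on {a<..<b} (\<lambda>x. g (exp (2 * p * x)) / sqrt (exp (2 * p * x)))"
      by (auto intro!: continuous_on_divide continuous_intros)
    moreover have "g (exp (2 * p * x)) / sqrt (exp (2 * p * x)) = u x" for x
      using p by (simp add: g_def)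
    ultimately show ?thesis by simp
  qed
  show ?thesis
  proof (cases "0 < p")
    case True
    then show ?thesis using * u by blast
  next
    case False
    then show ?thesis using *[of "- p"] u p by (simp add: hyperbolic_p_convex_on_uminus)
  qed
qed

section \<open>Integrability and symmetry\<close>

lemma borel_measurable_lebesgue_on_Icc_if_continuous_on_interior:
  fixes f :: "real \<Rightarrow> real"
  assumes "continuous_on {a<..<b} f"
  shows "f \<in> borel_measurable (lebesgue_on {a..b})"
proof -
  have "f \<in> borel_measurable (lebesgue_on {a<..<b})"
    using assms by (intro continuous_imp_measurable_on_sets_lebesgue) auto
  then have [measurable]: "(\<lambda>x. if x \<in> {a<..<b} then f x else 0) \<in> borel_measurable lebesgue"
    by (subst borel_measurable_if) auto
  have [measurable]: "{a} \<in> sets lebesgue" "{b} \<in> sets lebesgue" by auto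
  have "(\<lambda>x. if x \<in> {a..b} then f x else 0)
      = (if a \<le> b then (\<lambda>x. if x \<in> {a} then f a else if x \<in> {b} then f b
           else if x \<in> {a<..<b} then f x else 0) else (\<lambda>x. 0))"
    by (auto simp: fun_eq_iff)
  also have "\<dots> \<in> borel_measurable lebesgue"
    by simp
  finally show ?thesis
    by (subst (asm) borel_measurable_if) auto
qed

lemma set_integral_eq_0_if_antisymmetric:
  fixes f :: "real \<Rightarrow> real"
  assumes "\<And>x. x \<in> {a..b} \<Longrightarrow> f (a + b - x) = - f x"
  shows "(LINT x:{a..b}|lebesgue. f x) = 0"
proof -
  let ?g = "\<lambda>x. indicator {a..b} x *\<^sub>R f x"
  have "integral\<^sup>L lebesgue ?g = (LINT x|lebesgue. ?g ((a + b) + (- 1) * x))"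
    by (subst lebesgue_integral_real_affine[of "- 1" _ "a + b"]) auto
  also have "\<dots> = (LINT x|lebesgue. - ?g x)"
    by (rule Bochner_Integration.integral_cong) (auto simp: indicator_def assms)
  finally show ?thesis
    by (simp add: set_lebesgue_integral_def)
qed

section \<open>The weighted Hermite--Hadamard inequality\<close>

theorem theorem2p6:
  fixes I :: "real set" and p \<alpha> a b :: real and u v :: "real \<Rightarrow> real"
  assumes "is_interval I"
    and "p \<noteq> 0"
    and "0 < \<alpha>" and "\<alpha> < 1"
    and "hyperbolic_p_convex_on p I u"
    and "a \<in> I" and "b \<in> I" and "a < b"
    and "\<forall>x\<in>{a..b}. 0 < v x"
    and "set_integrable lebesgue {a..b} v"
    and "\<forall>x\<in>{a..b}. v (a + b - x) = v x"
  shows "frac_int_left \<alpha> a (\<lambda>x. u x * v x) b + frac_int_right \<alpha> b (\<lambda>x. u x * v x) a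
    \<le> (u a + u b) / 2 * (1 / cosh (p * (b - a) / 2)) * C2 p a b \<alpha> v
      + (u a - u b) / 2 * (1 / sinh (p * (b - a) / 2)) * S2 p a b \<alpha> v"
proof -
  define m where "m = (a + b) / 2"
  define kl where "kl x = exp (- ((1 - \<alpha>) / \<alpha>) * (b - x))" for x
  define kr where "kr x = exp (- ((1 - \<alpha>) / \<alpha>) * (x - a))" for x
  define W where "W x = (kl x + kr x) / \<alpha>" for x
  define P where "P = (u a + u b) / 2 / cosh (p * (b - a) / 2)"
  define Q where "Q = (u b - u a) / 2 / sinh (p * (b - a) / 2)"
  have sub: "{a..b} \<subseteq> I"
    using mem_is_interval_1_I[OF assms(1,6,7)] by auto
  have u: "hyperbolic_p_convex_on p {a..b} u"
    using assms(5) sub unfolding hyperbolic_p_convex_on_def by blast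

  have times_v: "set_integrable lebesgue {a..b} (\<lambda>x. f x * v x)"
    if "f \<in> borel_measurable (lebesgue_on {a..b})" "bounded (f ` {a..b})" for f
    using that assms(10)
    by (intro absolutely_integrable_bounded_measurable_product_real) auto
  have cont_times: "set_integrable lebesgue {a..b} (\<lambda>x. f x * g x)"
    if f: "continuous_on {a..b} f" and g: "set_integrable lebesgue {a..b} g" for f g :: "real \<Rightarrow> real"
    using f g
    by (intro absolutely_integrable_bounded_measurable_product_real
        continuous_imp_measurable_on_sets_lebesgue compact_imp_bounded compact_continuous_image) auto
  have uv: "set_integrable lebesgue {a..b} (\<lambda>x. u x * v x)"
    using hyperbolic_p_convex_on_bounded[OF u assms(2,8)]
      hyperbolic_p_convex_on_continuous[OF u assms(2)]
    by (intro times_v borel_measurable_lebesgue_on_Icc_if_continuous_on_interior)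
  have cont: "continuous_on {a..b} kl" "continuous_on {a..b} kr" "continuous_on {a..b} W"
    unfolding W_def kl_def kr_def using assms(3) by (auto intro!: continuous_intros)

  have Ci: "set_integrable lebesgue {a..b} (\<lambda>x. cosh (p * (x - m)) * W x * v x)"
   and Si: "set_integrable lebesgue {a..b} (\<lambda>x. sinh (p * (x - m)) * W x * v x)"
    by (intro cont_times assms(10) continuous_intros cont)+
  have S0: "S2 p a b \<alpha> v = 0"
    unfolding S2_def
  proof (rule set_integral_eq_0_if_antisymmetric, goal_cases)
    case (1 x)
    have "p * (a + b - x - (a + b) / 2) = - (p * (x - (a + b) / 2))"
      by (simp add: field_simps)
    moreover have "b - (a + b - x) = x - a" "a + b - x - a = b - x" by simp_all
    moreover have "v (a + b - x) = v x" using assms(11) 1 by blast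
    ultimately show ?case by (simp only: sinh_minus add.commute mult_minus_left)
  qed

  have "frac_int_left \<alpha> a (\<lambda>x. u x * v x) b + frac_int_right \<alpha> b (\<lambda>x. u x * v x) a
      = 1 / \<alpha> * ((LINT x:{a..b}|lebesgue. kl x * (u x * v x))
                + (LINT x:{a..b}|lebesgue. kr x * (u x * v x)))"
    unfolding frac_int_left_def frac_int_right_def kl_def kr_def by (simp add: distrib_left)
  also have "\<dots> = (LINT x:{a..b}|lebesgue. 1 / \<alpha> * (kl x * (u x * v x) + kr x * (u x * v x)))"
    using cont_times[OF cont(1) uv] cont_times[OF cont(2) uv]
    by (simp only: set_integral_mult_right set_integral_add(2))
  also have "\<dots> = (LINT x:{a..b}|lebesgue. W x * (u x * v x))"
    by (simp add: W_def field_simps)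
  also have "\<dots> \<le> (LINT x:{a..b}|lebesgue. P * (cosh (p * (x - m)) * W x * v x)
                                        + Q * (sinh (p * (x - m)) * W x * v x))"
  proof (rule set_integral_mono)
    show "set_integrable lebesgue {a..b} (\<lambda>x. W x * (u x * v x))"
      by (rule cont_times[OF cont(3) uv])
    show "set_integrable lebesgue {a..b} (\<lambda>x. P * (cosh (p * (x - m)) * W x * v x)
                                        + Q * (sinh (p * (x - m)) * W x * v x))"
      by (intro set_integral_add(1) set_integrable_mult_right Ci Si)
    fix x assume x: "x \<in> {a..b}"
    have "u x \<le> P * cosh (p * (x - m)) + Q * sinh (p * (x - m))"
      unfolding P_def Q_def m_def
      by (rule hyperbolic_p_convex_on_le_centred_chord[OF assms(5) sub assms(2,8) x])
    moreover have "0 \<le> W x * v x"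
      using assms(3,9) x by (auto simp: W_def kl_def kr_def add_nonneg_nonneg less_imp_le)
    ultimately have "W x * v x * u x
        \<le> W x * v x * (P * cosh (p * (x - m)) + Q * sinh (p * (x - m)))"
      by (rule mult_left_mono)
    then show "W x * (u x * v x) \<le> P * (cosh (p * (x - m)) * W x * v x)
                                  + Q * (sinh (p * (x - m)) * W x * v x)"
      by (simp add: algebra_simps)
  qed
  also have "\<dots> = P * C2 p a b \<alpha> v + Q * S2 p a b \<alpha> v"
    unfolding C2_def S2_def W_def kl_def kr_def m_def
    using Ci Si unfolding W_def kl_def kr_def m_def
    by (subst set_integral_add(2)) (auto intro!: set_integrable_mult_right)
  finally show ?thesis
    by (simp add: S0 P_def)
qed

end
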